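(* Let $\alpha=-2$. Then for $(c_{ij})_{1\leq i<j\leq 12}\in \mathbb{R}^{66}$ sufficiently general, the system of $66$ equations \[ \|x_i-x_j\|^\alpha + \|x_i-y_j\|^\alpha + \|y_i-x_j\|^\alpha + \|y_i-y_j\|^\alpha = c_{ij} \quad \text{for } 1 \leq i<j \leq 12 \] in the $72$ real unknowns given by the coordinates of $x_1,y_1,\ldots,x_{12},y_{12}\in\mathbb{R}^3$ has only finitely many solutions up to rigid transformations. In particular, for sufficiently general $(x_1^*,y_1^*,\ldots,x_{12}^*,y_{12}^* )\in(\mathbb{R}^3)^{24}$, the system \[ \|x_i-x_j\|^\alpha + \|x_i-y_j\|^\alpha + \|y_i-x_j\|^\alpha + \|y_i-y_j\|^\alpha = \|x_i^*-x_j^*\|^\alpha + \|x_i^*-y_j^*\|^\alpha + \|y_i^*-x_j^*\|^\alpha + \|y_i^*-y_j^*\|^\alpha \] for $1 \leq i<j \leq 12$ has finitely many solutions up to rigid transformations.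
   Context: $\|\cdot\|$ denotes the Euclidean norm on $\mathbb{R}^3$. Rigid transformations are the maps of $\mathbb{R}^3$ generated by translations and rotations, applied simultaneously to all $24$ points; "finitely many solutions up to rigid transformations" means the solution set is a finite union of orbits under this group. "Sufficiently general" means: outside some proper (lower-dimensional) algebraic subset of the relevant parameter space, i.e. for a generic choice. *)

theory Defs
  imports "HOL-Analysis.Analysis"
begin

inductive poly_fun :: "'v set \<Rightarrow> (('v \<Rightarrow> real) \<Rightarrow> real) \<Rightarrow> bool" for V where
  var: "v \<in> V \<Longrightarrow> poly_fun V (\<lambda>a. a v)"
| const: "poly_fun V (\<lambda>a. c)"
| add: "poly_fun V p \<Longrightarrow> poly_fun V q \<Longrightarrow> poly_fun V (\<lambda>a. p a + q a)"
| mult: "poly_fun V p \<Longrightarrow> poly_fun V q \<Longrightarrow> poly_fun V (\<lambda>a. p a * q a)"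

definition generic :: "'v set \<Rightarrow> (('v \<Rightarrow> real) \<Rightarrow> bool) \<Rightarrow> bool" where
  "generic V P \<longleftrightarrow> (\<exists>p. poly_fun V p \<and> (\<exists>a. p a \<noteq> 0) \<and> (\<forall>a. p a \<noteq> 0 \<longrightarrow> P a))"

definition alpha :: real where "alpha = -2"

definition E :: "(nat \<Rightarrow> real^3) \<Rightarrow> (nat \<Rightarrow> real^3) \<Rightarrow> nat \<Rightarrow> nat \<Rightarrow> real" where
  "E x y i j = norm (x i - x j) powr alpha + norm (x i - y j) powr alpha
             + norm (y i - x j) powr alpha + norm (y i - y j) powr alpha"

definition pairs12 :: "(nat \<times> nat) set" where
  "pairs12 = {(i, j). 1 \<le> i \<and> i < j \<and> j \<le> 12}"

text \<open>All terms appearing in the equations are defined (no zero differences).\<close>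
definition admissible :: "(nat \<Rightarrow> real^3) \<Rightarrow> (nat \<Rightarrow> real^3) \<Rightarrow> bool" where
  "admissible x y \<longleftrightarrow> (\<forall>(i, j)\<in>pairs12.
      x i \<noteq> x j \<and> x i \<noteq> y j \<and> y i \<noteq> x j \<and> y i \<noteq> y j)"

definition solution :: "(nat \<times> nat \<Rightarrow> real) \<Rightarrow> (nat \<Rightarrow> real^3) \<Rightarrow> (nat \<Rightarrow> real^3) \<Rightarrow> bool" where
  "solution c x y \<longleftrightarrow> admissible x y \<and> (\<forall>(i, j)\<in>pairs12. E x y i j = c (i, j))"

definition rigid_motion :: "(real^3 \<Rightarrow> real^3) \<Rightarrow> bool" where
  "rigid_motion f \<longleftrightarrow> (\<exists>R t. orthogonal_matrix R \<and> det R = 1 \<and> (\<forall>v. f v = R *v v + t))"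

definition finite_up_to_rigid :: "((nat \<Rightarrow> real^3) \<times> (nat \<Rightarrow> real^3)) set \<Rightarrow> bool" where
  "finite_up_to_rigid S \<longleftrightarrow> (\<exists>F. finite F \<and> (\<forall>(x, y)\<in>S. \<exists>(x0, y0)\<in>F. \<exists>f. rigid_motion f \<and>
      (\<forall>i\<in>{1..12}. x i = f (x0 i) \<and> y i = f (y0 i))))"

end

theory Submission
  imports Defs "HOL-Computational_Algebra.Polynomial"
begin

text \<open>
  A rigid motion brings any configuration into the position $x_1 = 0$, $y_1 \in \langle e_1\rangle$,
  $x_2 \in \langle e_1, e_2\rangle$, which leaves 66 free coordinates for 66 equations. Counting
  monomials, each free coordinate satisfies a nontrivial polynomial relation with the 66 rational
  functions on the left-hand sides. For generic $c$ its specialisation at $c$ is a nonzero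
  univariate polynomial, so every coordinate of a solution lies in a finite set of roots. This uses
  nothing about the equations except their number, and settles the first claim.

  The second claim needs in addition that a nonzero polynomial in $c$ cannot vanish on the whole
  image of the map $(x^*, y^*) \mapsto c$. This map has a surjective derivative at one explicit
  integer configuration, so its image has interior points. Surjectivity is certified modulo 5: along
  66 explicit integer directions the Jacobian, with rows cleared of denominators, becomes lower
  triangular modulo 5 with nonzero diagonal.
\<close>

subsection \<open>Polynomial functions\<close>

lemma poly_fun_sum:
  assumes "\<And>i. i \<in> I \<Longrightarrow> poly_fun V (p i)"
  shows "poly_fun V (\<lambda>a. \<Sum>i\<in>I. p i a)"
  using assms
proof (induction I rule: infinite_finite_induct)
  case (insert i I)
  have "poly_fun V (\<lambda>a. p i a + (\<Sum>i\<in>I. p i a))"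
    by (rule poly_fun.add) (use insert in auto)
  then show ?case using insert.hyps by simp
qed (auto intro: poly_fun.const)

lemma poly_fun_prod:
  assumes "\<And>i. i \<in> I \<Longrightarrow> poly_fun V (p i)"
  shows "poly_fun V (\<lambda>a. \<Prod>i\<in>I. p i a)"
  using assms
proof (induction I rule: infinite_finite_induct)
  case (insert i I)
  have "poly_fun V (\<lambda>a. p i a * (\<Prod>i\<in>I. p i a))"
    by (rule poly_fun.mult) (use insert in auto)
  then show ?case using insert.hyps by simp
qed (auto intro: poly_fun.const)

lemma poly_fun_power:
  assumes "poly_fun V p"
  shows "poly_fun V (\<lambda>a. p a ^ n)"
  by (induction n) (auto intro: poly_fun.const poly_fun.mult assms)

lemma poly_fun_diff:
  assumes "poly_fun V p" "poly_fun V q"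
  shows "poly_fun V (\<lambda>a. p a - q a)"
  using poly_fun.add[OF assms(1) poly_fun.mult[OF poly_fun.const[of V "-1"] assms(2)]] by simp

lemmas poly_fun_intros =
  poly_fun.const poly_fun.add poly_fun.mult poly_fun_diff poly_fun_power poly_fun_sum poly_fun_prod

lemma poly_fun_on_line:
  assumes "poly_fun V p"
  shows "\<exists>P. \<forall>t. poly P t = p (\<lambda>v. a v + t * b v)"
  using assms
proof induction
  case (var v)
  show ?case by (rule exI[of _ "[:a v, b v:]"]) simp
next
  case (const c)
  show ?case by (rule exI[of _ "[:c:]"]) simp
next
  case (add p q)
  then show ?case by (metis poly_add)
next
  case (mult p q)
  then show ?case by (metis poly_mult)
qed

lemma poly_fun_finite_zeros_on_line:
  assumes "poly_fun V p" "p (\<lambda>v. a v + b v) \<noteq> 0"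
  shows "finite {t. p (\<lambda>v. a v + t * b v) = 0}"
proof -
  obtain P where P: "\<And>t. poly P t = p (\<lambda>v. a v + t * b v)"
    using poly_fun_on_line[OF assms(1)] by metis
  have "P \<noteq> 0" using P[of 1] assms(2) by auto
  then show ?thesis using poly_roots_finite[of P] by (simp add: P)
qed

lemma poly_fun_mult_nonzero:
  assumes "poly_fun V p" "poly_fun V q" "p a \<noteq> 0" "q b \<noteq> 0"
  shows "\<exists>c. p c * q c \<noteq> 0"
proof -
  let ?l = "\<lambda>t::real. \<lambda>v. a v + t * (b v - a v)" and ?m = "\<lambda>t::real. \<lambda>v. b v + t * (a v - b v)"
  have "?l (1 - t) = ?m t" for t by (auto simp: algebra_simps)
  moreover have "finite {t. q (?l t) = 0}"
    by (rule poly_fun_finite_zeros_on_line[OF assms(2)]) (use assms(4) in simp)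
  moreover have "finite {t. p (?m t) = 0}"
    by (rule poly_fun_finite_zeros_on_line[OF assms(1)]) (use assms(3) in simp)
  ultimately have "finite ({t. q (?l t) = 0} \<union> (\<lambda>t. 1 - t) ` {t. p (?l (1 - t)) = 0})"
    by auto
  then obtain t where "t \<notin> {t. q (?l t) = 0} \<union> (\<lambda>t. 1 - t) ` {t. p (?l (1 - t)) = 0}"
    using ex_new_if_finite infinite_UNIV_char_0 by blast
  then have "q (?l t) \<noteq> 0" "p (?l t) \<noteq> 0"
    by (auto simp: image_iff dest: spec[of _ "1 - t"])
  then show ?thesis by (intro exI[of _ "?l t"]) simp
qed

lemma poly_fun_prod_nonzero:
  assumes "finite K" "\<And>k. k \<in> K \<Longrightarrow> poly_fun V (p k)" "\<And>k. k \<in> K \<Longrightarrow> \<exists>a. p k a \<noteq> 0"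
  shows "\<exists>a. (\<Prod>k\<in>K. p k a) \<noteq> 0"
  using assms
proof (induction K rule: finite_induct)
  case (insert k K)
  then obtain a b where "p k a \<noteq> 0" "(\<Prod>k\<in>K. p k b) \<noteq> 0" by (metis insert_iff)
  then have "\<exists>c. p k c * (\<Prod>k\<in>K. p k c) \<noteq> 0"
    using insert.prems(1) by (intro poly_fun_mult_nonzero[of V _ _ a b] poly_fun_prod) auto
  then show ?case using insert.hyps by simp
qed simp

definition deg_le :: "nat \<Rightarrow> (('v \<Rightarrow> real) \<Rightarrow> real) \<Rightarrow> bool" where
  "deg_le d p \<longleftrightarrow> (\<forall>v z. \<exists>P. degree P \<le> d \<and> (\<forall>t. p (z(v := t)) = poly P t))"

lemma deg_le_mono: "deg_le d p \<Longrightarrow> d \<le> d' \<Longrightarrow> deg_le d' p"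
  unfolding deg_le_def using order_trans by blast

lemma deg_le_const: "deg_le d (\<lambda>a. c)"
  unfolding deg_le_def by (auto intro!: exI[of _ "[:c:]"])

lemma deg_le_add:
  assumes "deg_le d p" "deg_le d q"
  shows "deg_le d (\<lambda>a. p a + q a)"
  unfolding deg_le_def
proof (intro allI)
  fix v z
  obtain P Q where "degree P \<le> d" "\<forall>t. p (z(v := t)) = poly P t"
    "degree Q \<le> d" "\<forall>t. q (z(v := t)) = poly Q t"
    using assms unfolding deg_le_def by metis
  then show "\<exists>R. degree R \<le> d \<and> (\<forall>t. p (z(v := t)) + q (z(v := t)) = poly R t)"
    by (intro exI[of _ "P + Q"]) (auto simp: degree_add_le)
qed

lemma deg_le_mult:
  assumes "deg_le d p" "deg_le d' q"
  shows "deg_le (d + d') (\<lambda>a. p a * q a)"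
  unfolding deg_le_def
proof (intro allI)
  fix v z
  obtain P Q where "degree P \<le> d" "\<forall>t. p (z(v := t)) = poly P t"
    "degree Q \<le> d'" "\<forall>t. q (z(v := t)) = poly Q t"
    using assms unfolding deg_le_def by metis
  then show "\<exists>R. degree R \<le> d + d' \<and> (\<forall>t. p (z(v := t)) * q (z(v := t)) = poly R t)"
    by (intro exI[of _ "P * Q"]) (auto intro: order_trans[OF degree_mult_le])
qed

lemma deg_le_power: "deg_le d p \<Longrightarrow> deg_le (n * d) (\<lambda>a. p a ^ n)"
  by (induction n) (auto intro: deg_le_const deg_le_mult)

lemma deg_le_sum:
  assumes "\<And>i. i \<in> I \<Longrightarrow> deg_le d (p i)"
  shows "deg_le d (\<lambda>a. \<Sum>i\<in>I. p i a)"
  using assms by (induction I rule: infinite_finite_induct) (auto intro: deg_le_const deg_le_add)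

lemma deg_le_prod:
  assumes "finite I" "\<And>i. i \<in> I \<Longrightarrow> deg_le d (p i)"
  shows "deg_le (card I * d) (\<lambda>a. \<Prod>i\<in>I. p i a)"
  using assms by (induction I rule: finite_induct) (auto intro: deg_le_const deg_le_mult)

lemma poly_fun_deg_le:
  assumes "poly_fun V p"
  shows "\<exists>d. deg_le d p"
  using assms
proof induction
  case (var v)
  have "\<exists>P. degree P \<le> 1 \<and> (\<forall>t. (z(w := t)) v = poly P t)" for w and z :: "'a \<Rightarrow> real"
    by (cases "v = w") (auto intro: exI[of _ "[:0, 1:]"] exI[of _ "[:z v:]"])
  then show ?case unfolding deg_le_def by blast
next
  case (add p q)
  then obtain d d' where "deg_le d p" "deg_le d' q" by blast
  then have "deg_le (max d d') (\<lambda>a. p a + q a)"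
    by (intro deg_le_add) (auto elim: deg_le_mono)
  then show ?case by blast
qed (blast intro: deg_le_const deg_le_mult)+

lemma vanishes_on_grid_imp_zero:
  assumes "deg_le d p" "finite W"
    and grid: "\<And>e. e \<in> PiE W (\<lambda>_. {..d}) \<Longrightarrow> p (\<lambda>v. if v \<in> W then real (e v) else 0) = 0"
    and z: "\<And>v. v \<notin> W \<Longrightarrow> z v = 0"
  shows "p z = 0"
proof -
  have "\<forall>z. (\<forall>v. v \<notin> W \<longrightarrow> z v = 0) \<and> (\<forall>v\<in>W - T. z v \<in> real ` {..d}) \<longrightarrow> p z = 0"
    if "finite T" "T \<subseteq> W" for T
    using that
  proof (induction T rule: finite_induct)
    case empty
    show ?case
    proof (intro allI impI)
      fix z assume z: "(\<forall>v. v \<notin> W \<longrightarrow> z v = 0) \<and> (\<forall>v\<in>W - {}. z v \<in> real ` {..d})"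
      then have "\<forall>v\<in>W. \<exists>n. n \<le> d \<and> z v = real n" by auto
      from bchoice[OF this] obtain e where e: "\<And>v. v \<in> W \<Longrightarrow> e v \<le> d \<and> z v = real (e v)"
        by blast
      have "p (\<lambda>v. if v \<in> W then real (restrict e W v) else 0) = 0"
        by (rule grid) (use e in auto)
      moreover have "(\<lambda>v. if v \<in> W then real (restrict e W v) else 0) = z"
        using e z by auto
      ultimately show "p z = 0" by simp
    qed
  next
    case (insert w T)
    show ?case
    proof (intro allI impI)
      fix z assume z: "(\<forall>v. v \<notin> W \<longrightarrow> z v = 0) \<and> (\<forall>v\<in>W - insert w T. z v \<in> real ` {..d})"
      obtain P where P: "degree P \<le> d" "\<And>t. p (z(w := t)) = poly P t"
        using assms(1) unfolding deg_le_def by blast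
      have "poly P t = 0" if "t \<in> real ` {..d}" for t
        using insert.IH insert.prems z that unfolding P(2)[symmetric] by auto
      then have "real ` {..d} \<subseteq> {t. poly P t = 0}" by blast
      moreover have "card (real ` {..d}) = Suc d" by (simp add: card_image)
      ultimately have "P = 0"
        using P(1) card_poly_roots_bound[of P] card_mono[OF poly_roots_finite[of P]]
        by (metis Suc_n_not_le_n order_trans)
      then show "p z = 0" using P(2)[of "z w"] by simp
    qed
  qed
  from this[OF assms(2) order_refl] show ?thesis using z by simp
qed

lemma homogeneous_system_nontrivial_solution:
  fixes C :: "'a \<Rightarrow> 'b \<Rightarrow> real"
  assumes "finite B" "finite A" "card B < card A"
  shows "\<exists>c. (\<exists>a\<in>A. c a \<noteq> 0) \<and> (\<forall>b\<in>B. (\<Sum>a\<in>A. c a * C a b) = 0)"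
  using assms
proof (induction B arbitrary: A C rule: finite_induct)
  case empty
  then have "A \<noteq> {}" by auto
  then show ?case by (intro exI[of _ "\<lambda>_. 1"]) auto
next
  case (insert b B)
  show ?case
  proof (cases "\<forall>a\<in>A. C a b = 0")
    case True
    obtain c where "\<exists>a\<in>A. c a \<noteq> 0" "\<forall>b\<in>B. (\<Sum>a\<in>A. c a * C a b) = 0"
      using insert.IH[of A C] insert.prems insert.hyps by auto
    then show ?thesis using True by (intro exI[of _ c]) auto
  next
    case False
    then obtain a0 where a0: "a0 \<in> A" "C a0 b \<noteq> 0" by blast
    define A' where "A' = A - {a0}"
    have A: "A = insert a0 A'" "a0 \<notin> A'" "finite A'"
      using a0 insert.prems by (auto simp: A'_def)
    have "card B < card A'" using insert.prems insert.hyps A by simp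
    then obtain c where c: "\<exists>a\<in>A'. c a \<noteq> 0"
      "\<forall>b'\<in>B. (\<Sum>a\<in>A'. c a * (C a b' - C a b * C a0 b' / C a0 b)) = 0"
      using insert.IH[of A' "\<lambda>a b'. C a b' - C a b * C a0 b' / C a0 b"] A(3) by blast
    define s where "s = (\<Sum>a\<in>A'. c a * C a b)"
    define c' where "c' = c(a0 := - s / C a0 b)"
    have sum: "(\<Sum>a\<in>A. c' a * C a b') = (\<Sum>a\<in>A'. c a * C a b') - s * C a0 b' / C a0 b" for b'
    proof -
      have "(\<Sum>a\<in>A'. c' a * C a b') = (\<Sum>a\<in>A'. c a * C a b')"
        by (rule sum.cong) (use A in \<open>auto simp: c'_def\<close>)
      then show ?thesis using A by (simp add: c'_def)
    qed
    have "(\<Sum>a\<in>A. c' a * C a b') = 0" if "b' \<in> insert b B" for b'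
    proof (cases "b' = b")
      case True
      then show ?thesis using a0 by (simp add: sum s_def)
    next
      case False
      then have "(\<Sum>a\<in>A'. c a * (C a b' - C a b * C a0 b' / C a0 b)) = 0" using c that by blast
      then show ?thesis
        by (simp add: sum s_def right_diff_distrib sum_subtractf sum_distrib_right sum_divide_distrib
            mult.assoc)
    qed
    moreover have "\<exists>a\<in>A. c' a \<noteq> 0" using c(1) A by (auto simp: c'_def)
    ultimately show ?thesis by blast
  qed
qed

lemma monomials_independent:
  fixes c :: "('i \<Rightarrow> nat) \<Rightarrow> real"
  assumes "finite I" "\<And>a. (\<Sum>e\<in>PiE I (\<lambda>_. {..m}). c e * (\<Prod>i\<in>I. a i ^ e i)) = 0"
    and "e \<in> PiE I (\<lambda>_. {..m})"
  shows "c e = 0"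
  using assms
proof (induction I arbitrary: c e rule: finite_induct)
  case empty
  then show ?case by simp
next
  case (insert i I)
  let ?P = "PiE I (\<lambda>_. {..m})"
  have inj: "inj_on (\<lambda>(k, e). e(i := k)) ({..m} \<times> ?P)"
    by (rule inj_onI) (clarsimp, metis (no_types, lifting) PiE_E fun_upd_apply fun_upd_triv fun_upd_upd insert.hyps(2))
  have expand: "(\<Sum>e\<in>PiE (insert i I) (\<lambda>_. {..m}). c e * (\<Prod>j\<in>insert i I. a j ^ e j))
      = (\<Sum>k\<le>m. (\<Sum>e\<in>?P. c (e(i := k)) * (\<Prod>j\<in>I. a j ^ e j)) * a i ^ k)" for a
  proof -
    have pr: "(\<Prod>j\<in>insert i I. a j ^ (e(i := k)) j) = a i ^ k * (\<Prod>j\<in>I. a j ^ e j)" for e k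
      using insert.hyps by (simp, intro disjI2 prod.cong) auto
    have "(\<Sum>e\<in>PiE (insert i I) (\<lambda>_. {..m}). c e * (\<Prod>j\<in>insert i I. a j ^ e j))
      = (\<Sum>(k, e)\<in>{..m} \<times> ?P. c (e(i := k)) * (\<Prod>j\<in>insert i I. a j ^ (e(i := k)) j))"
      unfolding PiE_insert_eq sum.reindex[OF inj] by (simp add: case_prod_unfold)
    also have "\<dots> = (\<Sum>k\<le>m. \<Sum>e\<in>?P. c (e(i := k)) * (a i ^ k * (\<Prod>j\<in>I. a j ^ e j)))"
      unfolding pr by (rule sum.cartesian_product[symmetric])
    finally show ?thesis by (simp add: sum_distrib_left mult_ac)
  qed
  have "(\<Sum>e\<in>?P. c (e(i := k)) * (\<Prod>j\<in>I. a j ^ e j)) = 0" if "k \<le> m" for a k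
  proof -
    have "(\<Sum>k\<le>m. (\<Sum>e\<in>?P. c (e(i := k)) * (\<Prod>j\<in>I. a j ^ e j)) * t ^ k) = 0" for t
    proof -
      have "(\<Prod>j\<in>I. (a(i := t)) j ^ e j) = (\<Prod>j\<in>I. a j ^ e j)" for e
        using insert.hyps by (intro prod.cong) auto
      then show ?thesis using insert.prems(1)[of "a(i := t)"] by (simp only: expand) simp
    qed
    from zero_polynom_imp_zero_coeffs[OF this that] show ?thesis .
  qed
  then have "c (e'(i := k)) = 0" if "k \<le> m" "e' \<in> ?P" for k e'
    using insert.IH[of "\<lambda>e. c (e(i := k))"] that by blast
  moreover obtain k e' where "k \<le> m" "e' \<in> ?P" "e = e'(i := k)"
    using insert.prems(2) unfolding PiE_insert_eq by auto
  ultimately show ?case by blast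
qed

subsection \<open>Generic fibres of square systems\<close>

text \<open>
  There are \<open>(m + 1) ^ (card I + 1)\<close> monomials of degree at most \<open>m\<close> in each of \<open>h\<close> and the \<open>f i\<close>.
  After multiplication with a power of \<open>G\<close> they become polynomials of degree \<open>O(m)\<close> in \<open>card W\<close>
  variables, for which vanishing amounts to \<open>O(m ^ card W)\<close> linear conditions. Hence a nontrivial
  linear combination of them vanishes if \<open>m\<close> is large.
\<close>

lemma algebraic_relation:
  fixes f :: "'i \<Rightarrow> ('v \<Rightarrow> real) \<Rightarrow> real"
  assumes "finite W" "finite I" "card W \<le> card I"
    and S: "S \<subseteq> {z. \<forall>v. v \<notin> W \<longrightarrow> z v = 0}"
    and "poly_fun V G" "\<And>i. i \<in> I \<Longrightarrow> poly_fun V (F i)" "poly_fun V h"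
    and G: "\<And>z. z \<in> S \<Longrightarrow> G z \<noteq> 0"
    and F: "\<And>z i. z \<in> S \<Longrightarrow> i \<in> I \<Longrightarrow> F i z = G z * f i z"
  shows "\<exists>m c. (\<exists>j\<le>m. \<exists>e\<in>PiE I (\<lambda>_. {..m}). c j e \<noteq> 0) \<and>
    (\<forall>z\<in>S. (\<Sum>j\<le>m. (\<Sum>e\<in>PiE I (\<lambda>_. {..m}). c j e * (\<Prod>i\<in>I. f i z ^ e i)) * h z ^ j) = 0)"
proof -
  obtain dG dh where dG: "deg_le dG G" and dh: "deg_le dh h"
    using poly_fun_deg_le assms(5,7) by metis
  have "\<forall>i\<in>I. \<exists>d. deg_le d (F i)" using poly_fun_deg_le assms(6) by metis
  from bchoice[OF this] obtain dF where dF: "\<And>i. i \<in> I \<Longrightarrow> deg_le (dF i) (F i)" by blast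
  define D where "D = dG + dh + (\<Sum>i\<in>I. dF i)"
  have DG: "deg_le D G" and Dh: "deg_le D h"
    using dG dh by (auto elim!: deg_le_mono simp: D_def)
  have DF: "deg_le D (F i)" if "i \<in> I" for i
    using dF[OF that] by (rule deg_le_mono)
      (use that assms(2) in \<open>simp add: D_def member_le_sum trans_le_add2\<close>)
  define K m where "K = (card I + 1) * D" and "m = (K + 1) ^ card W"
  let ?M = "{..m} \<times> PiE I (\<lambda>_. {..m})"
  define H where "H = (\<lambda>(j, e) z. h z ^ j * (\<Prod>i\<in>I. F i z ^ e i * G z ^ (m - e i)))"
  have H: "deg_le (K * m) (H je)" if je: "je \<in> ?M" for je
  proof -
    obtain j e where eq: "je = (j, e)" and j: "j \<le> m" and e: "\<And>i. i \<in> I \<Longrightarrow> e i \<le> m"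
      using je by (cases je) auto
    have "deg_le (m * D) (\<lambda>z. F i z ^ e i * G z ^ (m - e i))" if "i \<in> I" for i
      using deg_le_mult[OF deg_le_power[OF DF[OF that], of "e i"] deg_le_power[OF DG, of "m - e i"]]
        e[OF that] by (simp add: add_mult_distrib[symmetric])
    then have "deg_le (j * D + card I * (m * D)) (H je)"
      unfolding H_def eq by (auto intro!: deg_le_mult deg_le_power Dh deg_le_prod assms(2))
    then show ?thesis
      by (rule deg_le_mono) (use j in \<open>simp add: K_def algebra_simps\<close>)
  qed
  have cardM: "card ?M = (m + 1) ^ (card I + 1)"
    by (simp add: card_cartesian_product card_PiE assms(2))
  have "card (PiE W (\<lambda>_. {..K * m})) = (K * m + 1) ^ card W"
    by (simp add: card_PiE assms(1))
  also have "\<dots> \<le> ((K + 1) * (m + 1)) ^ card W" by (intro power_mono) auto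
  also have "\<dots> = m * (m + 1) ^ card W" by (simp only: power_mult_distrib m_def)
  also have "\<dots> < (m + 1) ^ (card W + 1)" by simp
  also have "\<dots> \<le> card ?M" unfolding cardM by (intro power_increasing) (use assms(3) in auto)
  finally have "card (PiE W (\<lambda>_. {..K * m})) < card ?M" .
  moreover have "finite (PiE W (\<lambda>_. {..K * m}))" "finite ?M"
    using assms(1,2) by (auto intro!: finite_PiE finite_cartesian_product)
  ultimately obtain c where c: "\<exists>je\<in>?M. c je \<noteq> 0"
    "\<forall>g\<in>PiE W (\<lambda>_. {..K * m}). (\<Sum>je\<in>?M. c je * H je (\<lambda>v. if v \<in> W then real (g v) else 0)) = 0"
    using homogeneous_system_nontrivial_solution[of "PiE W (\<lambda>_. {..K * m})" ?M
        "\<lambda>je g. H je (\<lambda>v. if v \<in> W then real (g v) else 0)"] by blast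
  have deg: "deg_le (K * m) (\<lambda>z. \<Sum>je\<in>?M. c je * H je z)"
    by (intro deg_le_sum) (use deg_le_mult[OF deg_le_const[of 0] H] in simp)
  have "(\<Sum>j\<le>m. (\<Sum>e\<in>PiE I (\<lambda>_. {..m}). c (j, e) * (\<Prod>i\<in>I. f i z ^ e i)) * h z ^ j) = 0"
    (is "?R = 0") if z: "z \<in> S" for z
  proof -
    have "(\<Sum>je\<in>?M. c je * H je z) = 0"
      by (rule vanishes_on_grid_imp_zero[OF deg assms(1)]) (use c S z in auto)
    moreover have "H (j, e) z = (G z ^ m) ^ card I * ((\<Prod>i\<in>I. f i z ^ e i) * h z ^ j)"
      if "e \<in> PiE I (\<lambda>_. {..m})" for j e
    proof -
      have "(\<Prod>i\<in>I. F i z ^ e i * G z ^ (m - e i)) = (\<Prod>i\<in>I. G z ^ m * f i z ^ e i)"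
      proof (rule prod.cong)
        fix i assume i: "i \<in> I"
        then have "e i \<le> m" using that by auto
        then have "G z ^ m = G z ^ e i * G z ^ (m - e i)" by (simp add: power_add[symmetric])
        then show "F i z ^ e i * G z ^ (m - e i) = G z ^ m * f i z ^ e i"
          by (simp add: F[OF z i] power_mult_distrib)
      qed simp
      then show ?thesis by (simp add: H_def prod.distrib)
    qed
    then have "(\<Sum>je\<in>?M. c je * H je z) = (\<Sum>(j, e)\<in>?M. c (j, e) * ((G z ^ m) ^ card I * ((\<Prod>i\<in>I. f i z ^ e i) * h z ^ j)))"
      by (intro sum.cong) auto
    then have "(\<Sum>je\<in>?M. c je * H je z) = (G z ^ m) ^ card I * ?R"
      by (simp add: sum.cartesian_product[symmetric] sum_distrib_left sum_distrib_right mult_ac)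
    ultimately show ?thesis using G[OF z] by simp
  qed
  moreover have "\<exists>j\<le>m. \<exists>e\<in>PiE I (\<lambda>_. {..m}). c (j, e) \<noteq> 0" using c(1) by auto
  ultimately show ?thesis by (intro exI[of _ m] exI[of _ "\<lambda>j e. c (j, e)"]) blast
qed

lemma generic_finite_fibre:
  fixes f :: "'i \<Rightarrow> ('v \<Rightarrow> real) \<Rightarrow> real"
  assumes "finite W" "finite I" "card W \<le> card I" "W \<subseteq> V"
    and S: "S \<subseteq> {z. \<forall>v. v \<notin> W \<longrightarrow> z v = 0}"
    and "poly_fun V G" "\<And>i. i \<in> I \<Longrightarrow> poly_fun V (F i)"
    and "\<And>z. z \<in> S \<Longrightarrow> G z \<noteq> 0"
    and "\<And>z i. z \<in> S \<Longrightarrow> i \<in> I \<Longrightarrow> F i z = G z * f i z"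
  shows "generic I (\<lambda>c. finite {z \<in> S. \<forall>i\<in>I. f i z = c i})"
proof -
  let ?P = "\<lambda>m. PiE I (\<lambda>_. {..m})"
  let ?rel = "\<lambda>v m c j. j \<le> m \<and> (\<exists>e\<in>?P m. c j e \<noteq> 0) \<and>
      (\<forall>z\<in>S. (\<Sum>j\<le>m. (\<Sum>e\<in>?P m. c j e * (\<Prod>i\<in>I. f i z ^ e i)) * z v ^ j) = 0)"
  have "\<forall>v\<in>W. \<exists>m c j. ?rel v m c j"
  proof
    fix v assume "v \<in> W"
    then have "poly_fun V (\<lambda>z. z v)" using assms(4) by (auto intro: poly_fun.var)
    from algebraic_relation[where f = f and F = F and G = G and h = "\<lambda>z. z v",
        OF assms(1-3) S assms(6,7) this assms(8,9)]
    show "\<exists>m c j. ?rel v m c j" by blast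
  qed
  from bchoice[OF this] obtain m where "\<forall>v\<in>W. \<exists>c j. ?rel v (m v) c j" by (rule exE)
  from bchoice[OF this] obtain c where "\<forall>v\<in>W. \<exists>j. ?rel v (m v) (c v) j" by (rule exE)
  from bchoice[OF this] obtain j where rel: "\<forall>v\<in>W. ?rel v (m v) (c v) (j v)" by (rule exE)
  define q where "q = (\<lambda>v k a. \<Sum>e\<in>?P (m v). c v k e * (\<Prod>i\<in>I. a i ^ e i))"
  have q: "poly_fun I (q v k)" for v k
    unfolding q_def by (auto intro!: poly_fun_intros poly_fun.var)
  have "\<exists>a. q v (j v) a \<noteq> 0" if "v \<in> W" for v
    using bspec[OF rel that] monomials_independent[OF assms(2), where m = "m v" and c = "c v (j v)"]
    unfolding q_def by blast
  then have "\<exists>a. (\<Prod>v\<in>W. q v (j v) a) \<noteq> 0"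
    by (intro poly_fun_prod_nonzero[OF assms(1), of I] q)
  moreover have "finite {z \<in> S. \<forall>i\<in>I. f i z = a i}" if "(\<Prod>v\<in>W. q v (j v) a) \<noteq> 0" for a
  proof -
    define B where "B = (\<Union>v\<in>W. {t. (\<Sum>k\<le>m v. q v k a * t ^ k) = 0})"
    have "finite B"
      unfolding B_def using that rel assms(1) by (intro finite_UN_I polyfun_roots_finite) auto
    have "z v \<in> B" if "z \<in> S" "\<forall>i\<in>I. f i z = a i" "v \<in> W" for z v
    proof -
      have "(\<Prod>i\<in>I. f i z ^ e i) = (\<Prod>i\<in>I. a i ^ e i)" for e
        by (rule prod.cong) (use that in auto)
      moreover have "(\<Sum>k\<le>m v. (\<Sum>e\<in>?P (m v). c v k e * (\<Prod>i\<in>I. f i z ^ e i)) * z v ^ k) = 0"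
        using rel that(1,3) by blast
      ultimately show ?thesis using that(3) by (auto simp: B_def q_def intro!: bexI[of _ v])
    qed
    then have "{z \<in> S. \<forall>i\<in>I. f i z = a i} \<subseteq> {z. \<forall>v. (v \<in> W \<longrightarrow> z v \<in> B) \<and> (v \<notin> W \<longrightarrow> z v = 0)}"
      using S by auto
    then show ?thesis
      by (rule finite_subset) (rule finite_set_of_finite_funs[OF assms(1) \<open>finite B\<close>])
  qed
  ultimately show ?thesis
    unfolding generic_def by (intro exI[of _ "\<lambda>a. \<Prod>v\<in>W. q v (j v) a"]) (auto intro: poly_fun_prod q)
qed

subsection \<open>Configurations up to rigid motions\<close>

definition coords :: "(bool \<times> nat \<times> 3) set" where
  "coords = UNIV \<times> {1..12} \<times> UNIV"

definition pt :: "(bool \<times> nat \<times> 3 \<Rightarrow> real) \<Rightarrow> bool \<Rightarrow> nat \<Rightarrow> real^3" where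
  "pt a b i = (\<chi> k. a (b, i, k))"

definition sqd :: "(bool \<times> nat \<times> 3 \<Rightarrow> real) \<Rightarrow> bool \<Rightarrow> nat \<Rightarrow> bool \<Rightarrow> nat \<Rightarrow> real" where
  "sqd a b i c j = (\<Sum>k\<in>UNIV. (a (b, i, k) - a (c, j, k))\<^sup>2)"

lemma sqd_eq: "sqd a b i c j = (norm (pt a b i - pt a c j))\<^sup>2"
  unfolding power2_norm_eq_inner by (simp add: sqd_def pt_def inner_vec_def power2_eq_square)

lemma sqd_eq_0_iff: "sqd a b i c j = 0 \<longleftrightarrow> pt a b i = pt a c j"
  by (simp add: sqd_eq)

lemma E_pt:
  "E (pt a False) (pt a True) i j =
    1 / sqd a False i False j + 1 / sqd a False i True j + 1 / sqd a True i False j + 1 / sqd a True i True j"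
proof -
  have "norm v powr alpha = 1 / (norm v)\<^sup>2" for v :: "real^3"
    by (simp add: alpha_def powr_minus_divide powr_numeral)
  then show ?thesis by (simp add: E_def sqd_eq)
qed

lemma finite_pairs12: "finite pairs12"
  by (rule finite_subset[of _ "{..12} \<times> {..12}"]) (auto simp: pairs12_def)

lemma finite_coords: "finite coords"
  by (simp add: coords_def)

lemma poly_fun_sqd:
  assumes "i \<in> {1..12}" "j \<in> {1..12}"
  shows "poly_fun coords (\<lambda>a. sqd a b i c j)"
  unfolding sqd_def using assms by (intro poly_fun_intros poly_fun.var) (auto simp: coords_def)

definition quad :: "(bool \<times> nat \<times> 3 \<Rightarrow> real) \<Rightarrow> nat \<times> nat \<Rightarrow> real" where
  "quad a = (\<lambda>(i, j). sqd a False i False j * sqd a False i True j * sqd a True i False j * sqd a True i True j)"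

definition denom :: "(bool \<times> nat \<times> 3 \<Rightarrow> real) \<Rightarrow> real" where
  "denom a = (\<Prod>ij\<in>pairs12. quad a ij)"

definition numer :: "nat \<times> nat \<Rightarrow> (bool \<times> nat \<times> 3 \<Rightarrow> real) \<Rightarrow> real" where
  "numer = (\<lambda>(i, j) a.
     (sqd a False i True j * sqd a True i False j * sqd a True i True j
      + sqd a False i False j * sqd a True i False j * sqd a True i True j
      + sqd a False i False j * sqd a False i True j * sqd a True i True j
      + sqd a False i False j * sqd a False i True j * sqd a True i False j)
     * (\<Prod>ij\<in>pairs12 - {(i, j)}. quad a ij))"

lemma poly_fun_quad: "ij \<in> pairs12 \<Longrightarrow> poly_fun coords (\<lambda>a. quad a ij)"
  unfolding quad_def by (auto simp: pairs12_def intro!: poly_fun_intros poly_fun_sqd)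

lemma poly_fun_denom: "poly_fun coords denom"
  unfolding denom_def by (intro poly_fun_prod poly_fun_quad)

lemma poly_fun_numer:
  assumes "ij \<in> pairs12"
  shows "poly_fun coords (numer ij)"
proof -
  obtain i j where ij: "ij = (i, j)" "i \<in> {1..12}" "j \<in> {1..12}"
    using assms by (cases ij) (auto simp: pairs12_def)
  show ?thesis unfolding numer_def ij(1) prod.case
    by (intro poly_fun_intros poly_fun_quad poly_fun_sqd ij(2,3)) auto
qed

lemma admissible_iff_denom: "admissible (pt a False) (pt a True) \<longleftrightarrow> denom a \<noteq> 0"
  unfolding admissible_def denom_def quad_def using finite_pairs12
  by (auto simp: sqd_eq_0_iff)

lemma numer_eq:
  assumes "denom a \<noteq> 0" "(i, j) \<in> pairs12"
  shows "numer (i, j) a = denom a * E (pt a False) (pt a True) i j"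
proof -
  have q: "quad a (i, j) \<noteq> 0" using assms finite_pairs12 by (auto simp: denom_def)
  have "denom a = quad a (i, j) * (\<Prod>ij\<in>pairs12 - {(i, j)}. quad a ij)"
    unfolding denom_def by (rule prod.remove[OF finite_pairs12 assms(2)])
  then show ?thesis
    using q by (simp add: numer_def E_pt quad_def field_simps)
qed

lemma rigid_motion_dist:
  assumes "rigid_motion f"
  shows "norm (f u - f v) = norm (u - v)"
proof -
  obtain R t where R: "orthogonal_matrix R" "\<And>v. f v = R *v v + t"
    using assms unfolding rigid_motion_def by blast
  have "f u - f v = R *v (u - v)" by (simp add: R(2) matrix_vector_mult_diff_distrib)
  moreover have "orthogonal_transformation ((*v) R)"
    using R(1) by (simp add: orthogonal_transformation_matrix)
  ultimately show ?thesis by (simp add: orthogonal_transformation_norm)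
qed

lemma ex_unit_orthogonal2:
  fixes p q :: "real^3"
  shows "\<exists>r. norm r = 1 \<and> r \<bullet> p = 0 \<and> r \<bullet> q = 0"
proof -
  have "card {p, q} \<le> 2" by (simp add: card_insert_if)
  then have "dim {p, q} < DIM(real^3)"
    using dim_le_card[of "{p, q}" "{p, q}"] by (simp add: span_superset)
  then obtain x where "x \<noteq> 0" "\<And>y. y \<in> span {p, q} \<Longrightarrow> orthogonal x y"
    using orthogonal_to_subspace_exists[of "{p, q}"] by blast
  then show ?thesis
    by (intro exI[of _ "x /\<^sub>R norm x"]) (auto simp: orthogonal_def span_base)
qed

lemma ex_rotation_to_flag:
  fixes u w :: "real^3"
  shows "\<exists>R :: real^3^3. orthogonal_matrix R \<and> det R = 1 \<and>
    (R *v u) $ 2 = 0 \<and> (R *v u) $ 3 = 0 \<and> (R *v w) $ 3 = 0"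
proof -
  obtain r3 where r3: "norm r3 = 1" "r3 \<bullet> u = 0" "r3 \<bullet> w = 0" using ex_unit_orthogonal2 by blast
  obtain r2 where r2: "norm r2 = 1" "r2 \<bullet> u = 0" "r2 \<bullet> r3 = 0" using ex_unit_orthogonal2 by blast
  obtain r1 where r1: "norm r1 = 1" "r1 \<bullet> r2 = 0" "r1 \<bullet> r3 = 0" using ex_unit_orthogonal2 by blast
  define R :: "real \<Rightarrow> real^3^3" where
    "R s = (\<chi> i. if i = 1 then s *\<^sub>R r1 else if i = 2 then r2 else r3)" for s
  have rows: "row 1 (R s) = s *\<^sub>R r1" "row 2 (R s) = r2" "row 3 (R s) = r3" for s
    by (simp_all add: row_def R_def vec_eq_iff)
  have orth: "orthogonal_matrix (R s)" if "\<bar>s\<bar> = 1" for s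
    unfolding orthogonal_matrix_orthonormal_rows
    using r1 r2 r3 that by (simp add: forall_3 rows orthogonal_def inner_commute)
  have "(R s *v v) $ i = row i (R s) \<bullet> v" for s v i
    by (simp add: matrix_vector_mult_def row_def inner_vec_def)
  then have flag: "(R s *v u) $ 2 = 0" "(R s *v u) $ 3 = 0" "(R s *v w) $ 3 = 0" for s
    using r2 r3 by (simp_all add: rows)
  have "det (R (-1)) = - det (R 1)" by (simp add: det_3 R_def)
  moreover have "det (R 1) = 1 \<or> det (R 1) = -1" by (rule det_orthogonal_matrix) (simp add: orth)
  ultimately have "\<exists>s. \<bar>s\<bar> = 1 \<and> det (R s) = 1" by (metis abs_minus_cancel abs_one minus_minus)
  then show ?thesis using orth flag by blast
qed

definition gauge_coords :: "(bool \<times> nat \<times> 3) set" where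
  "gauge_coords = {(False, 1, 1), (False, 1, 2), (False, 1, 3), (True, 1, 2), (True, 1, 3), (False, 2, 3)}"

lemma ex_normal_form:
  "\<exists>z f. rigid_motion f \<and> (\<forall>v. v \<notin> coords - gauge_coords \<longrightarrow> z v = 0) \<and>
     (\<forall>i\<in>{1..12}. x i = f (pt z False i) \<and> y i = f (pt z True i))"
proof -
  obtain R :: "real^3^3" where R: "orthogonal_matrix R" "det R = 1"
    "(R *v (y 1 - x 1)) $ 2 = 0" "(R *v (y 1 - x 1)) $ 3 = 0" "(R *v (x 2 - x 1)) $ 3 = 0"
    using ex_rotation_to_flag by blast
  define z where "z = (\<lambda>(b, i, k). if i \<in> {1..12} then (R *v ((if b then y i else x i) - x 1)) $ k else 0)"
  define f where "f v = transpose R *v v + x 1" for v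
  have "rigid_motion f"
    unfolding rigid_motion_def f_def using R(1,2) by (auto simp: det_transpose intro!: exI[of _ "transpose R"])
  moreover have "z v = 0" if "v \<notin> coords - gauge_coords" for v
    using that R(3-5) by (cases v) (auto simp: z_def coords_def gauge_coords_def)
  moreover have "x i = f (pt z False i) \<and> y i = f (pt z True i)" if "i \<in> {1..12}" for i
  proof -
    have "pt z b i = R *v ((if b then y i else x i) - x 1)" for b
      using that by (simp add: pt_def z_def vec_eq_iff)
    moreover have "transpose R *v (R *v v) = v" for v
      using R(1) by (simp add: matrix_vector_mul_assoc orthogonal_matrix)
    ultimately show ?thesis by (simp add: f_def)
  qed
  ultimately show ?thesis by blast
qed

lemma card_pairs12: "card pairs12 = 66"
proof -
  have "card (Sigma {1..12::nat} (\<lambda>i. {Suc i..12})) = (\<Sum>i\<in>{1..12}. 12 - i)"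
    by (subst card_SigmaI) auto
  also have "\<dots> = 66" by code_simp
  also have "Sigma {1..12::nat} (\<lambda>i. {Suc i..12}) = pairs12" by (auto simp: pairs12_def)
  finally show ?thesis .
qed

lemma card_free_coords: "card (coords - gauge_coords) = 66"
proof -
  have "card gauge_coords = 6" by (simp add: gauge_coords_def)
  moreover have "card coords = 72" by (simp add: coords_def card_cartesian_product card_UNIV_bool)
  moreover have "gauge_coords \<subseteq> coords" by (auto simp: coords_def gauge_coords_def)
  ultimately show ?thesis by (simp add: card_Diff_subset gauge_coords_def)
qed

lemma generic_finite_up_to_rigid:
  "generic pairs12 (\<lambda>c. finite_up_to_rigid {(x, y). solution c x y})"
proof -
  define S where "S = {z. (\<forall>v. v \<notin> coords - gauge_coords \<longrightarrow> z v = 0) \<and> denom z \<noteq> 0}"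
  let ?E = "\<lambda>(i, j) z. E (pt z False) (pt z True) i j"
  have "generic pairs12 (\<lambda>c. finite {z \<in> S. \<forall>ij\<in>pairs12. ?E ij z = c ij})"
  proof (rule generic_finite_fibre[where W = "coords - gauge_coords" and V = coords and G = denom and F = numer])
    show "numer ij z = denom z * ?E ij z" if "z \<in> S" "ij \<in> pairs12" for z ij
      using that numer_eq by (cases ij) (auto simp: S_def)
  qed (auto simp: S_def finite_pairs12 card_pairs12 card_free_coords finite_coords intro: poly_fun_denom poly_fun_numer)
  moreover have "finite_up_to_rigid {(x, y). solution c x y}"
    if fin: "finite {z \<in> S. \<forall>ij\<in>pairs12. ?E ij z = c ij}" for c
    unfolding finite_up_to_rigid_def
  proof (intro exI conjI ballI)
    let ?F = "(\<lambda>z. (pt z False, pt z True)) ` {z \<in> S. \<forall>ij\<in>pairs12. ?E ij z = c ij}"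
    show "finite ?F" using fin by simp
    fix xy assume "xy \<in> {(x, y). solution c x y}"
    then obtain x y where xy: "xy = (x, y)" "solution c x y" by blast
    obtain z f where f: "rigid_motion f" and z: "\<forall>v. v \<notin> coords - gauge_coords \<longrightarrow> z v = 0"
      and eq: "\<forall>i\<in>{1..12}. x i = f (pt z False i) \<and> y i = f (pt z True i)"
      using ex_normal_form[of x y] by blast
    note dist = rigid_motion_dist[OF f]
    have ij: "i \<in> {1..12} \<and> j \<in> {1..12}" if "(i, j) \<in> pairs12" for i j
      using that by (auto simp: pairs12_def)
    have "E x y i j = E (pt z False) (pt z True) i j" if "(i, j) \<in> pairs12" for i j
      using ij[OF that] eq by (simp add: E_def dist)
    moreover have "admissible (pt z False) (pt z True)"
      unfolding admissible_def
    proof (clarify, intro conjI notI)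
    qed (use xy(2) ij eq in \<open>fastforce simp: solution_def admissible_def\<close>)+
    ultimately have "z \<in> {z \<in> S. \<forall>ij\<in>pairs12. ?E ij z = c ij}"
      using xy(2) z by (auto simp: S_def solution_def admissible_iff_denom)
    then show "case xy of (x, y) \<Rightarrow> \<exists>(x0, y0)\<in>?F. \<exists>f. rigid_motion f \<and>
        (\<forall>i\<in>{1..12}. x i = f (x0 i) \<and> y i = f (y0 i))"
      using f eq unfolding xy(1) prod.case by (intro bexI[of _ "(pt z False, pt z True)"]) auto
  qed
  ultimately show ?thesis unfolding generic_def by blast
qed

subsection \<open>Density of the image\<close>

definition bil :: "(bool \<times> nat \<times> 3 \<Rightarrow> real) \<Rightarrow> (bool \<times> nat \<times> 3 \<Rightarrow> real) \<Rightarrow> bool \<Rightarrow> nat \<Rightarrow> bool \<Rightarrow> nat \<Rightarrow> real" where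
  "bil a w b i c j = (\<Sum>k\<in>UNIV. (a (b, i, k) - a (c, j, k)) * (w (b, i, k) - w (c, j, k)))"

text \<open>
  Up to the factor \<open>-2 / (quad a (i, j))\<^sup>2\<close>, this is the derivative at \<open>a\<close> in direction \<open>w\<close> of the
  \<open>(i, j)\<close>-th left-hand side; unlike the derivative it is polynomial in \<open>a\<close> and \<open>w\<close>.
\<close>

definition jac :: "(bool \<times> nat \<times> 3 \<Rightarrow> real) \<Rightarrow> (bool \<times> nat \<times> 3 \<Rightarrow> real) \<Rightarrow> nat \<times> nat \<Rightarrow> real" where
  "jac a w = (\<lambda>(i, j).
     (sqd a False i True j * sqd a True i False j * sqd a True i True j)\<^sup>2 * bil a w False i False j
   + (sqd a False i False j * sqd a True i False j * sqd a True i True j)\<^sup>2 * bil a w False i True j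
   + (sqd a False i False j * sqd a False i True j * sqd a True i True j)\<^sup>2 * bil a w True i False j
   + (sqd a False i False j * sqd a False i True j * sqd a True i False j)\<^sup>2 * bil a w True i True j)"

definition dE :: "(bool \<times> nat \<times> 3 \<Rightarrow> real) \<Rightarrow> (bool \<times> nat \<times> 3 \<Rightarrow> real) \<Rightarrow> nat \<times> nat \<Rightarrow> real" where
  "dE a w = (\<lambda>(i, j). - 2 * bil a w False i False j / (sqd a False i False j)\<^sup>2
     - 2 * bil a w False i True j / (sqd a False i True j)\<^sup>2
     - 2 * bil a w True i False j / (sqd a True i False j)\<^sup>2
     - 2 * bil a w True i True j / (sqd a True i True j)\<^sup>2)"

lemma jac_eq_dE:
  assumes "quad a ij \<noteq> 0"
  shows "2 * jac a w ij = - (quad a ij)\<^sup>2 * dE a w ij"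
  using assms by (cases ij) (simp add: jac_def dE_def quad_def field_simps power2_eq_square)

lemma poly_fun_cong:
  assumes "poly_fun V p" "\<And>v. v \<in> V \<Longrightarrow> a v = b v"
  shows "p a = p b"
  using assms by induction auto

lemma bil_sum: "bil a (\<lambda>v. \<Sum>l\<in>L. t l * u l v) b i c j = (\<Sum>l\<in>L. t l * bil a (u l) b i c j)"
proof -
  have "bil a (\<lambda>v. \<Sum>l\<in>L. t l * u l v) b i c j
      = (\<Sum>k\<in>UNIV. \<Sum>l\<in>L. t l * ((a (b, i, k) - a (c, j, k)) * (u l (b, i, k) - u l (c, j, k))))"
    by (simp add: bil_def sum_subtractf[symmetric] sum_distrib_left algebra_simps)
  also have "\<dots> = (\<Sum>l\<in>L. t l * bil a (u l) b i c j)"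
    unfolding bil_def sum_distrib_left by (rule sum.swap)
  finally show ?thesis .
qed

lemma jac_sum: "jac a (\<lambda>v. \<Sum>l\<in>L. t l * u l v) ij = (\<Sum>l\<in>L. t l * jac a (u l) ij)"
  by (cases ij) (simp add: jac_def bil_sum sum_distrib_left sum.distrib[symmetric] algebra_simps)

context
  fixes a :: "bool \<times> nat \<times> 3 \<Rightarrow> real" and u :: "'n::finite \<Rightarrow> bool \<times> nat \<times> 3 \<Rightarrow> real"
begin

definition comb :: "real^'n \<Rightarrow> bool \<times> nat \<times> 3 \<Rightarrow> real" where
  "comb t v = (\<Sum>l\<in>UNIV. t $ l * u l v)"

definition conf :: "real^'n \<Rightarrow> bool \<times> nat \<times> 3 \<Rightarrow> real" where
  "conf t v = a v + comb t v"

lemma conf_0: "conf 0 = a"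
  by (simp add: conf_def comb_def fun_eq_iff)

lemma conf_has_derivative: "((\<lambda>t. conf t v) has_derivative (\<lambda>t. comb t v)) (at x)"
  unfolding conf_def comb_def
  by (auto intro!: derivative_eq_intros bounded_linear.has_derivative[OF bounded_linear_vec_nth])

lemma continuous_on_conf: "continuous_on S (\<lambda>t. conf t v)"
  unfolding conf_def comb_def by (intro continuous_intros)

lemma continuous_on_sqd: "continuous_on S (\<lambda>t. sqd (conf t) b i c j)"
  unfolding sqd_def by (intro continuous_intros continuous_on_conf)

lemma sqd_has_derivative:
  "((\<lambda>t. sqd (conf t) b i c j) has_derivative (\<lambda>t. 2 * bil a (comb t) b i c j)) (at 0)"
proof -
  have "((\<lambda>t. sqd (conf t) b i c j) has_derivative (\<lambda>t. \<Sum>k\<in>UNIV. of_nat 2 *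
      (comb t (b, i, k) - comb t (c, j, k)) * (conf 0 (b, i, k) - conf 0 (c, j, k)) ^ (2 - 1))) (at 0)"
    unfolding sqd_def
    by (intro has_derivative_sum has_derivative_power has_derivative_diff conf_has_derivative)
  then show ?thesis by (simp add: bil_def conf_0 sum_distrib_left algebra_simps)
qed

lemma inverse_sqd_has_derivative:
  assumes "sqd a b i c j \<noteq> 0"
  shows "((\<lambda>t. 1 / sqd (conf t) b i c j) has_derivative
    (\<lambda>t. - 2 * bil a (comb t) b i c j / (sqd a b i c j)\<^sup>2)) (at 0)"
  using assms
  by (auto intro!: derivative_eq_intros sqd_has_derivative simp: conf_0 power2_eq_square)

lemma E_has_derivative:
  assumes "quad a (i, j) \<noteq> 0"
  shows "((\<lambda>t. E (pt (conf t) False) (pt (conf t) True) i j) has_derivative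
    (\<lambda>t. dE a (comb t) (i, j))) (at 0)"
proof -
  note D = inverse_sqd_has_derivative
  have "sqd a False i False j \<noteq> 0" "sqd a False i True j \<noteq> 0" "sqd a True i False j \<noteq> 0"
    "sqd a True i True j \<noteq> 0" using assms by (auto simp: quad_def)
  from has_derivative_add[OF has_derivative_add[OF has_derivative_add[OF
        D[OF this(1)] D[OF this(2)]] D[OF this(3)]] D[OF this(4)]]
  show ?thesis unfolding E_pt dE_def prod.case by simp
qed

lemma ex_nonvanishing:
  fixes prs :: "'n \<Rightarrow> nat \<times> nat"
  assumes prs: "bij_betw prs UNIV pairs12" and "denom a \<noteq> 0"
    and inj: "\<And>t :: real^'n. (\<And>r. (\<Sum>l\<in>UNIV. t $ l * jac a (u l) (prs r)) = 0) \<Longrightarrow> t = 0"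
    and p: "poly_fun pairs12 p" "p c \<noteq> 0"
  shows "\<exists>b. denom b \<noteq> 0 \<and> p (\<lambda>(i, j). E (pt b False) (pt b True) i j) \<noteq> 0"
proof -
  let ?E = "\<lambda>b (i, j). E (pt b False) (pt b True) i j"
  define \<Psi> :: "real^'n \<Rightarrow> real^'n" where "\<Psi> t = (\<chi> r. ?E (conf t) (prs r))" for t
  define D :: "real^'n \<Rightarrow> real^'n" where "D t = (\<chi> r. dE a (comb t) (prs r))" for t
  define S where "S = {t. denom (conf t) \<noteq> 0}"
  have prs_in: "prs r \<in> pairs12" for r using prs by (auto simp: bij_betw_def)
  have quad: "quad (conf t) (prs r) \<noteq> 0" if "denom (conf t) \<noteq> 0" for t r
    using that prs_in finite_pairs12 by (auto simp: denom_def)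
  have "continuous_on UNIV (\<lambda>t. denom (conf t))"
    unfolding denom_def quad_def case_prod_unfold by (intro continuous_intros continuous_on_sqd)
  then have "open (S :: (real^'n) set)"
    unfolding S_def by (rule open_Collect_neq[OF _ continuous_on_const])
  have "0 \<in> S" using assms(2) by (simp add: S_def conf_0)
  have "continuous_on S \<Psi>"
  proof -
    have "continuous_on S (\<lambda>t. ?E (conf t) (prs r))" for r
      using quad[of _ r] unfolding case_prod_unfold E_pt quad_def
      by (intro continuous_intros continuous_on_sqd) (auto simp: S_def)
    then show ?thesis unfolding \<Psi>_def by (rule continuous_on_vec_lambda)
  qed
  have "(\<Psi> has_derivative D) (at 0)"
  proof -
    have "((\<lambda>t. ?E (conf t) (prs r)) has_derivative (\<lambda>t. dE a (comb t) (prs r))) (at 0)" for r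
      using E_has_derivative[of "fst (prs r)" "snd (prs r)"] quad[of 0 r] assms(2)
      by (simp add: conf_0 case_prod_unfold)
    then show ?thesis
      unfolding has_derivative_componentwise_within[of \<Psi>]
      by (auto simp: Basis_vec_def inner_axis \<Psi>_def D_def)
  qed
  then have "linear D" by (rule has_derivative_linear)
  have "t = 0" if "D t = 0" for t
  proof (rule inj)
    fix r
    have "dE a (comb t) (prs r) = 0" using that by (simp add: D_def vec_eq_iff)
    then have "jac a (comb t) (prs r) = 0"
      using jac_eq_dE[of a "prs r" "comb t"] quad[of 0 r] assms(2) by (simp add: conf_0)
    then show "(\<Sum>l\<in>UNIV. t $ l * jac a (u l) (prs r)) = 0"
      unfolding comb_def[abs_def] jac_sum .
  qed
  then have "inj D" using \<open>linear D\<close> linear_injective_0 by blast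
  then have "surj D" using \<open>linear D\<close> linear_injective_imp_surjective by blast
  then obtain g where "linear g" "D \<circ> g = id"
    using \<open>linear D\<close> linear_surjective_right_inverse by blast
  then have "\<Psi> 0 \<in> interior (\<Psi> ` S)"
    using sussmann_open_mapping[OF \<open>open S\<close> \<open>continuous_on S \<Psi>\<close> \<open>0 \<in> S\<close> \<open>(\<Psi> has_derivative D) (at 0)\<close> _ _ order_refl]
      \<open>0 \<in> S\<close> \<open>open S\<close> by (simp add: interior_open linear_conv_bounded_linear)
  then obtain e where e: "e > 0" "ball (\<Psi> 0) e \<subseteq> \<Psi> ` S"
    by (meson mem_interior)
  define c' :: "real^'n" where "c' = (\<chi> r. c (prs r))"
  define line :: "real \<Rightarrow> nat \<times> nat \<Rightarrow> real" where "line x ij = ?E a ij + x * (c ij - ?E a ij)" for x ij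
  have "finite {x. p (line x) = 0}"
    unfolding line_def by (rule poly_fun_finite_zeros_on_line[OF p(1)]) (use p(2) in simp)
  define \<delta> where "\<delta> = e / (norm (c' - \<Psi> 0) + 1)"
  have "\<delta> > 0" using e(1) by (simp add: \<delta>_def add_nonneg_pos)
  then have "infinite {0<..<\<delta>}" by simp
  with \<open>finite {x. p (line x) = 0}\<close> obtain x where x: "0 < x" "x < \<delta>" "p (line x) \<noteq> 0"
    by (metis (mono_tags, lifting) finite_subset greaterThanLessThan_iff mem_Collect_eq subsetI)
  have "x * norm (c' - \<Psi> 0) \<le> x * (norm (c' - \<Psi> 0) + 1)" using x(1) by simp
  also have "\<dots> < e" using x(2) by (simp only: \<delta>_def pos_less_divide_eq add_nonneg_pos[OF norm_ge_zero zero_less_one])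
  finally have "\<Psi> 0 + x *\<^sub>R (c' - \<Psi> 0) \<in> ball (\<Psi> 0) e"
    using x(1) by (simp add: dist_norm)
  then obtain t where t: "t \<in> S" "\<Psi> t = \<Psi> 0 + x *\<^sub>R (c' - \<Psi> 0)" using e(2) by auto
  have "?E (conf t) ij = line x ij" if ij: "ij \<in> pairs12" for ij
  proof -
    obtain r where "ij = prs r" using ij bij_betw_imp_surj_on[OF prs] by blast
    then show ?thesis using arg_cong[OF t(2), of "\<lambda>v. v $ r"] by (simp add: \<Psi>_def c'_def line_def conf_0)
  qed
  then have "p (?E (conf t)) = p (line x)" by (rule poly_fun_cong[OF p(1)])
  then show ?thesis using x(3) t(1) by (auto simp: S_def)
qed

end

lemma poly_fun_clear_denominators:
  assumes "poly_fun pairs12 p"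
  shows "\<exists>r m. poly_fun coords r \<and>
    (\<forall>a. denom a \<noteq> 0 \<longrightarrow> r a = denom a ^ m * p (\<lambda>(i, j). E (pt a False) (pt a True) i j))"
  using assms
proof induction
  case (var ij)
  then show ?case
    by (intro exI[of _ "numer ij"] exI[of _ 1]) (cases ij, auto intro: poly_fun_numer simp: numer_eq)
next
  case (const c)
  show ?case by (intro exI[of _ "\<lambda>_. c"] exI[of _ 0]) (auto intro: poly_fun.const)
next
  case (add p q)
  then obtain r m s n where "poly_fun coords r" "poly_fun coords s"
    "\<forall>a. denom a \<noteq> 0 \<longrightarrow> r a = denom a ^ m * p (\<lambda>(i, j). E (pt a False) (pt a True) i j)"
    "\<forall>a. denom a \<noteq> 0 \<longrightarrow> s a = denom a ^ n * q (\<lambda>(i, j). E (pt a False) (pt a True) i j)"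
    by blast
  then show ?case
    by (intro exI[of _ "\<lambda>a. denom a ^ n * r a + denom a ^ m * s a"] exI[of _ "m + n"])
      (auto intro!: poly_fun_intros poly_fun_denom simp: power_add algebra_simps)
next
  case (mult p q)
  then obtain r m s n where "poly_fun coords r" "poly_fun coords s"
    "\<forall>a. denom a \<noteq> 0 \<longrightarrow> r a = denom a ^ m * p (\<lambda>(i, j). E (pt a False) (pt a True) i j)"
    "\<forall>a. denom a \<noteq> 0 \<longrightarrow> s a = denom a ^ n * q (\<lambda>(i, j). E (pt a False) (pt a True) i j)"
    by blast
  then show ?case
    by (intro exI[of _ "\<lambda>a. r a * s a"] exI[of _ "m + n"])
      (auto intro!: poly_fun_intros simp: power_add)
qed

text \<open>
  Eliminating the last unknown with the last row keeps the matrix integral and lower triangular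
  modulo \<open>p\<close>, because the pivot is a unit modulo \<open>p\<close>.
\<close>

lemma lower_triangular_mod_prime_kernel:
  fixes A :: "nat \<Rightarrow> nat \<Rightarrow> int" and t :: "nat \<Rightarrow> real"
  assumes "prime p" "\<And>k. k < n \<Longrightarrow> \<not> p dvd A k k" "\<And>k l. k < l \<Longrightarrow> l < n \<Longrightarrow> p dvd A k l"
    and "\<And>k. k < n \<Longrightarrow> (\<Sum>l<n. t l * of_int (A k l)) = 0" and "l < n"
  shows "t l = 0"
  using assms(2-)
proof (induction n arbitrary: A l)
  case (Suc n)
  define B where "B k l = A n n * A k l - A k n * A n l" for k l
  have "t l = 0" if "l < n" for l
  proof (rule Suc.IH[of B])
    show "\<not> p dvd B k k" if "k < n" for k
      using Suc.prems(1)[of n] Suc.prems(1)[of k] Suc.prems(2)[of k n] that \<open>prime p\<close>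
      by (simp add: B_def dvd_diff_left_iff prime_dvd_mult_iff)
    show "p dvd B k l" if "k < l" "l < n" for k l
      using Suc.prems(2)[of k l] Suc.prems(2)[of k n] that by (simp add: B_def)
    show "(\<Sum>l<n. t l * of_int (B k l)) = 0" if "k < n" for k
    proof -
      have "(\<Sum>l<n. t l * of_int (B k l)) =
          A n n * (\<Sum>l<n. t l * of_int (A k l)) - A k n * (\<Sum>l<n. t l * of_int (A n l))"
        by (simp add: B_def sum_distrib_left sum_subtractf algebra_simps)
      also have "(\<Sum>l<n. t l * of_int (A k l)) = - t n * A k n"
        using Suc.prems(3)[of k] that by (simp add: eq_neg_iff_add_eq_0)
      also have "(\<Sum>l<n. t l * of_int (A n l)) = - t n * A n n"
        using Suc.prems(3)[of n] by (simp add: eq_neg_iff_add_eq_0)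
      finally show ?thesis by simp
    qed
  qed (use that in auto)
  moreover have "t n = 0"
    using Suc.prems(1)[of n] Suc.prems(3)[of n] calculation by auto
  ultimately show ?case using Suc.prems(4) less_Suc_eq by auto
qed simp

subsection \<open>An integer configuration with nonsingular Jacobian\<close>

type_synonym vec3 = "int \<times> int \<times> int"

fun ip :: "vec3 \<Rightarrow> vec3 \<Rightarrow> int" where
  "ip (a, b, c) (a', b', c') = a * a' + b * b' + c * c'"

fun diff :: "vec3 \<Rightarrow> vec3 \<Rightarrow> vec3" where
  "diff (a, b, c) (a', b', c') = (a - a', b - b', c - c')"

fun scale_mod :: "int \<Rightarrow> vec3 \<Rightarrow> vec3" where
  "scale_mod w (a, b, c) = (w * a mod 5, w * b mod 5, w * c mod 5)"

definition sqlen :: "vec3 \<Rightarrow> int" where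
  "sqlen v = ip v v"

text \<open>
  The certificate was found by computer search: \<open>base\<close> lists the pairs \<open>(x i, y i)\<close> for
  \<open>i = 1, ..., 12\<close>, chosen such that the Jacobian has rank 66 modulo 5. The \<open>l\<close>-th entry of
  \<open>directions\<close> lists the nonzero components \<open>(i, dx i, dy i)\<close> of a direction that is annihilated
  modulo 5 by the rows before the \<open>l\<close>-th in the order of \<open>pair_list\<close>, but not by the \<open>l\<close>-th.
\<close>

definition base :: "(vec3 \<times> vec3) list" where
  "base = [
    ((1,4,2),(2,0,3)), ((3,3,4),(0,1,1)), ((0,3,3),(2,4,1)), ((4,3,4),(3,4,0)), ((1,1,2),(4,4,4)),
    ((4,3,0),(3,4,1)), ((1,2,0),(0,2,2)), ((0,2,1),(0,3,4)), ((2,0,2),(1,2,1)), ((1,2,2),(2,1,1)),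
    ((2,0,0),(3,1,3)), ((4,4,0),(4,2,0))]"

definition directions :: "(nat \<times> vec3 \<times> vec3) list list" where
  "directions = [
    [(2,(0,0,0),(1,0,0))], [(3,(0,0,0),(0,0,1))], [(3,(1,0,0),(0,0,0))], [(4,(0,0,0),(1,0,0))],
    [(2,(0,0,0),(1,1,0))], [(3,(0,1,0),(0,0,0))], [(5,(0,0,0),(0,1,0))], [(5,(1,0,0),(0,1,0))],
    [(5,(3,0,0),(1,2,0))], [(5,(2,0,0),(3,3,1))], [(6,(0,0,0),(0,0,1))], [(6,(0,0,0),(0,1,0))],
    [(6,(0,0,1),(0,0,0))], [(6,(0,1,0),(0,0,0))], [(5,(0,1,0),(3,0,3))], [(7,(0,0,0),(0,1,0))],
    [(7,(0,0,0),(0,0,1))], [(7,(1,0,0),(0,0,4))], [(7,(2,0,1),(0,0,2))], [(5,(4,0,1),(0,0,0))],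
    [(6,(1,3,3),(0,0,0))], [(8,(0,1,0),(0,0,0))], [(8,(0,3,0),(1,0,0))], [(8,(1,1,0),(4,0,0))],
    [(8,(1,0,0),(3,0,1))], [(8,(2,0,0),(1,1,3))], [(8,(4,3,1),(3,4,1))],
    [(5,(2,1,3),(3,0,3)),(6,(1,2,3),(1,1,2)),(8,(3,2,4),(3,2,2))], [(9,(0,0,0),(0,0,1))],
    [(9,(1,0,0),(0,0,0))], [(9,(3,0,0),(1,0,0))], [(9,(4,1,0),(0,0,0))], [(9,(2,3,0),(3,1,3))],
    [(5,(2,4,3),(2,0,2)),(6,(2,2,1),(4,4,3)),(7,(1,0,1),(1,2,4)),(8,(3,3,1),(0,1,2))],
    [(9,(1,0,1),(0,0,0))],
    [(3,(3,2,1),(0,0,0)),(5,(1,2,3),(3,1,2)),(6,(3,0,1),(2,2,4)),(7,(3,0,2),(3,1,3)),(8,(4,4,0),(1,4,4))],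
    [(10,(0,0,0),(0,1,0))], [(10,(0,0,1),(0,0,0))], [(10,(0,1,1),(0,0,0))],
    [(10,(0,3,0),(1,0,0))], [(10,(1,2,3),(1,0,0))], [(10,(3,1,3),(2,2,1))],
    [(5,(3,2,2),(1,0,1)),(6,(2,4,1),(2,2,4)),(7,(3,1,4),(2,4,1)),(8,(4,3,1),(3,4,1)),(9,(4,4,3),(4,3,4)),(10,(3,1,0),(4,3,4))],
    [(3,(1,3,2),(1,0,0)),(5,(3,1,0),(2,2,0)),(6,(0,0,4),(1,1,2)),(7,(3,1,0),(2,4,0)),(8,(2,4,4),(2,0,2)),(9,(0,3,0),(0,3,4)),(10,(2,1,4),(1,1,3))],
    [(3,(4,2,3),(2,1,2)),(5,(2,1,2),(0,1,4)),(6,(4,0,3),(1,1,2)),(7,(3,3,3),(0,0,2)),(8,(2,2,3),(2,1,4)),(9,(2,0,0),(3,3,4)),(10,(3,2,3),(0,3,4))],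
    [(11,(0,0,0),(0,1,0))], [(11,(0,0,0),(0,4,1))], [(11,(0,0,1),(0,0,0))],
    [(11,(0,0,3),(1,1,3))], [(11,(1,0,0),(4,0,0))], [(11,(4,1,1),(4,4,2))],
    [(2,(0,1,0),(3,4,0)),(3,(1,1,2),(3,0,0)),(5,(3,3,3),(2,2,0)),(6,(3,3,3),(1,2,2)),(7,(4,0,4),(1,2,4)),(9,(1,1,2),(4,2,1)),(10,(0,3,4),(1,2,1)),(11,(2,0,0),(3,2,3))],
    [(2,(0,2,1),(4,0,0)),(3,(0,2,1),(3,2,4)),(5,(2,1,4),(1,3,3)),(6,(0,0,1),(0,4,0)),(7,(4,3,0),(2,4,4)),(8,(2,2,1),(1,0,1)),(9,(3,1,2),(2,0,0)),(10,(4,4,0),(4,1,3)),(11,(0,1,1),(3,4,2))],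
    [(2,(1,4,0),(4,2,0)),(3,(0,0,3),(3,2,4)),(5,(1,2,4),(1,2,4)),(6,(1,2,1),(4,3,3)),(7,(2,4,0),(2,4,1)),(8,(4,1,0),(0,2,2)),(9,(3,2,3),(3,2,1)),(10,(1,1,1),(2,2,1)),(11,(0,3,3),(4,0,3))],
    [(2,(0,3,1),(1,4,1)),(3,(1,4,3),(2,1,2)),(5,(4,4,2),(0,2,3)),(6,(2,4,1),(2,2,4)),(7,(2,4,2),(2,4,4)),(8,(4,2,4),(4,3,2)),(9,(0,0,1),(2,1,3)),(10,(0,0,2),(3,0,0)),(11,(4,0,3),(0,1,0))],
    [(12,(0,0,1),(0,0,0))], [(12,(0,1,4),(0,0,0))], [(12,(1,0,4),(0,0,0))],
    [(12,(0,0,0),(1,0,0))], [(12,(0,0,0),(0,0,1))], [(12,(0,0,0),(2,1,2))],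
    [(2,(2,0,4),(1,0,0)),(3,(3,3,1),(1,2,4)),(4,(0,0,0),(4,0,1)),(5,(4,0,3),(2,0,0)),(6,(1,4,0),(1,4,2)),(7,(0,2,4),(2,4,0)),(8,(3,0,0),(3,0,2)),(9,(4,1,0),(4,3,4)),(10,(4,1,3),(3,0,0)),(11,(2,3,1),(3,2,0)),(12,(2,2,1),(1,1,2))],
    [(2,(1,0,0),(4,0,2)),(3,(1,3,0),(3,0,0)),(4,(0,1,0),(0,0,2)),(5,(2,0,0),(3,1,3)),(6,(1,3,0),(1,1,2)),(7,(2,0,0),(0,0,1)),(8,(2,3,0),(1,0,1)),(9,(3,3,4),(4,2,1)),(10,(3,3,2),(1,1,3)),(11,(1,2,0),(2,0,0)),(12,(3,2,0),(0,0,1))],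
    [(2,(0,1,1),(1,1,0)),(3,(4,4,4),(3,0,0)),(4,(1,0,0),(1,0,4)),(5,(3,1,0),(2,3,4)),(6,(3,4,1),(2,0,4)),(7,(2,2,3),(4,3,3)),(8,(1,4,4),(4,4,0)),(9,(4,3,3),(3,0,0)),(10,(3,0,3),(3,3,4)),(11,(3,0,1),(2,3,2)),(12,(2,0,3),(2,3,4))],
    [(2,(3,2,0),(4,0,2)),(3,(0,4,4),(3,1,2)),(4,(1,2,1),(1,0,1)),(5,(3,4,0),(3,1,3)),(6,(2,3,0),(1,3,2)),(7,(4,2,4),(2,4,2)),(8,(4,3,2),(2,0,4)),(9,(1,3,0),(2,4,2)),(10,(4,2,4),(0,0,0)),(11,(0,0,3),(4,3,3)),(12,(1,1,3),(2,3,2))],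
    [(1,(0,0,0),(1,0,0)),(2,(4,0,3),(1,0,3)),(3,(0,2,0),(3,0,0)),(4,(0,1,0),(1,0,3)),(5,(2,0,2),(0,3,3)),(6,(0,0,0),(2,3,4)),(7,(3,1,0),(4,3,0)),(8,(1,2,0),(2,2,3)),(9,(0,3,2),(2,3,4)),(10,(3,2,1),(3,1,3)),(11,(0,2,0),(1,2,4)),(12,(4,4,2),(4,4,0))]]"

definition block :: "(nat \<times> vec3 \<times> vec3) list \<Rightarrow> nat \<Rightarrow> vec3 \<times> vec3" where
  "block u i = (case map_of u i of None \<Rightarrow> ((0, 0, 0), (0, 0, 0)) | Some b \<Rightarrow> b)"

definition pair_list :: "(nat \<times> nat) list" where
  "pair_list = concat (map (\<lambda>j. map (\<lambda>i. (i, j)) [1..<j]) [2..<13])"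

fun forms_mod :: "vec3 \<Rightarrow> vec3 \<Rightarrow> vec3 \<Rightarrow> vec3 \<Rightarrow> vec3 \<times> vec3 \<times> vec3 \<times> vec3" where
  "forms_mod d1 d2 d3 d4 =
    (scale_mod ((sqlen d2 * sqlen d3 * sqlen d4)\<^sup>2) d1,
     scale_mod ((sqlen d1 * sqlen d3 * sqlen d4)\<^sup>2) d2,
     scale_mod ((sqlen d1 * sqlen d2 * sqlen d4)\<^sup>2) d3,
     scale_mod ((sqlen d1 * sqlen d2 * sqlen d3)\<^sup>2) d4)"

fun diffs :: "vec3 \<times> vec3 \<Rightarrow> vec3 \<times> vec3 \<Rightarrow> vec3 \<times> vec3 \<times> vec3 \<times> vec3" where
  "diffs (x, y) (x', y') = (diff x x', diff x y', diff y x', diff y y')"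

fun entry :: "vec3 \<times> vec3 \<times> vec3 \<times> vec3 \<Rightarrow> vec3 \<times> vec3 \<times> vec3 \<times> vec3 \<Rightarrow> int" where
  "entry (g1, g2, g3, g4) (d1, d2, d3, d4) = ip g1 d1 + ip g2 d2 + ip g3 d3 + ip g4 d4"

definition row_mod :: "nat \<times> nat \<Rightarrow> nat \<times> nat \<times> vec3 \<times> vec3 \<times> vec3 \<times> vec3" where
  "row_mod = (\<lambda>(i, j). (i, j, (\<lambda>(d1, d2, d3, d4). forms_mod d1 d2 d3 d4)
     (diffs (base ! (i - 1)) (base ! (j - 1)))))"

fun entry_mod :: "nat \<times> nat \<times> vec3 \<times> vec3 \<times> vec3 \<times> vec3 \<Rightarrow> (nat \<times> vec3 \<times> vec3) list \<Rightarrow> int" where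
  "entry_mod (i, j, g) u = entry g (diffs (block u i) (block u j)) mod 5"

fun lower_triangular :: "('a \<Rightarrow> 'b \<Rightarrow> int) \<Rightarrow> 'a list \<Rightarrow> 'b list \<Rightarrow> bool" where
  "lower_triangular f [] us = (us = [])"
| "lower_triangular f (r # rs) [] = False"
| "lower_triangular f (r # rs) (u # us) =
    (f r u \<noteq> 0 \<and> list_all (\<lambda>u'. f r u' = 0) us \<and> lower_triangular f rs us)"

lemma lower_triangular_nth:
  assumes "lower_triangular f rs us"
  shows "length us = length rs"
    and "k < length rs \<Longrightarrow> f (rs ! k) (us ! k) \<noteq> 0"
    and "k < l \<Longrightarrow> l < length rs \<Longrightarrow> f (rs ! k) (us ! l) = 0"
proof -
  show len: "length us = length rs"
    using assms by (induction f rs us rule: lower_triangular.induct) auto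
  show "f (rs ! k) (us ! k) \<noteq> 0" if "k < length rs"
    using assms that by (induction f rs us arbitrary: k rule: lower_triangular.induct) (auto simp: nth_Cons')
  show "f (rs ! k) (us ! l) = 0" if "k < l" "l < length rs"
    using assms that len
    by (induction f rs us arbitrary: k l rule: lower_triangular.induct)
      (auto simp: nth_Cons' list_all_length)
qed

lemma lower_triangular_directions: "lower_triangular entry_mod (map row_mod pair_list) directions"
  by code_simp

lemma length_pair_list: "length pair_list = 66"
  by code_simp

lemma distinct_pair_list: "distinct pair_list"
  by code_simp

lemma base_distinct:
  "list_all (\<lambda>(i, j). (\<lambda>(d1, d2, d3, d4). sqlen d1 * sqlen d2 * sqlen d3 * sqlen d4)
     (diffs (base ! (i - 1)) (base ! (j - 1))) \<noteq> 0) pair_list"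
  by code_simp

lemma set_pair_list: "set pair_list = pairs12"
proof -
  have "set pair_list = (\<Union>j\<in>{2..<13}. (\<lambda>i. (i, j)) ` {1..<j})"
    by (simp only: pair_list_def set_concat set_map set_upt image_image)
  also have "\<dots> = pairs12" by (force simp: pairs12_def)
  finally show ?thesis .
qed

definition jac_int :: "nat \<times> nat \<Rightarrow> (nat \<times> vec3 \<times> vec3) list \<Rightarrow> int" where
  "jac_int = (\<lambda>(i, j) u. (\<lambda>(d1, d2, d3, d4) (e1, e2, e3, e4).
      (sqlen d2 * sqlen d3 * sqlen d4)\<^sup>2 * ip d1 e1 + (sqlen d1 * sqlen d3 * sqlen d4)\<^sup>2 * ip d2 e2
    + (sqlen d1 * sqlen d2 * sqlen d4)\<^sup>2 * ip d3 e3 + (sqlen d1 * sqlen d2 * sqlen d3)\<^sup>2 * ip d4 e4)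
    (diffs (base ! (i - 1)) (base ! (j - 1))) (diffs (block u i) (block u j)))"

lemma ip_scale_mod: "ip (scale_mod w d) e mod 5 = w * ip d e mod 5"
proof -
  obtain a b c a' b' c' where "d = (a, b, c)" "e = (a', b', c')" by (metis prod_cases3)
  then have "ip (scale_mod w d) e mod 5 = (w * a * a' + w * b * b' + w * c * c') mod 5"
    by simp (intro mod_add_cong mod_mult_left_eq)
  then show ?thesis using \<open>d = _\<close> \<open>e = _\<close> by (simp add: algebra_simps)
qed

lemma entry_mod_eq: "entry_mod (row_mod ij) u = jac_int ij u mod 5"
proof -
  obtain i j where ij: "ij = (i, j)" by (cases ij)
  obtain d1 d2 d3 d4 where "diffs (base ! (i - 1)) (base ! (j - 1)) = (d1, d2, d3, d4)" by (metis prod_cases4)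
  moreover obtain e1 e2 e3 e4 where "diffs (block u i) (block u j) = (e1, e2, e3, e4)" by (metis prod_cases4)
  ultimately show ?thesis
    by (simp add: ij row_mod_def jac_int_def) (intro mod_add_cong ip_scale_mod)
qed

fun comp :: "vec3 \<Rightarrow> 3 \<Rightarrow> int" where
  "comp (a, b, c) k = (if k = 1 then a else if k = 2 then b else c)"

definition realise :: "(nat \<Rightarrow> vec3 \<times> vec3) \<Rightarrow> bool \<times> nat \<times> 3 \<Rightarrow> real" where
  "realise B = (\<lambda>(b, i, k). of_int (comp ((if b then snd else fst) (B i)) k))"

lemma bil_realise:
  "bil (realise A) (realise B) b i c j =
    of_int (ip (diff ((if b then snd else fst) (A i)) ((if c then snd else fst) (A j)))
      (diff ((if b then snd else fst) (B i)) ((if c then snd else fst) (B j))))"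
proof -
  have "(\<Sum>k\<in>UNIV. (real_of_int (comp p k) - of_int (comp q k)) * (of_int (comp r k) - of_int (comp s k)))
      = of_int (ip (diff p q) (diff r s))" for p q r s
    by (cases p; cases q; cases r; cases s) (simp add: sum_3)
  then show ?thesis by (simp add: bil_def realise_def)
qed

lemma sqd_eq_bil: "sqd a b i c j = bil a a b i c j"
  by (simp add: sqd_def bil_def power2_eq_square)

lemma diffs_eq: "diffs p q = (diff (fst p) (fst q), diff (fst p) (snd q), diff (snd p) (fst q), diff (snd p) (snd q))"
  by (cases p; cases q) simp

abbreviation "base_conf \<equiv> realise (\<lambda>i. base ! (i - 1))"

lemma jac_base_conf: "jac base_conf (realise (block u)) ij = of_int (jac_int ij u)"
  by (cases ij) (simp add: jac_def jac_int_def sqd_eq_bil bil_realise diffs_eq sqlen_def)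

lemma denom_base_conf: "denom base_conf \<noteq> 0"
proof -
  have "quad base_conf ij \<noteq> 0" if "ij \<in> pairs12" for ij
    using base_distinct that unfolding set_pair_list[symmetric] list_all_iff
    by (cases ij) (fastforce simp: quad_def sqd_eq_bil bil_realise diffs_eq sqlen_def)
  then show ?thesis using finite_pairs12 by (simp add: denom_def)
qed

lemma image_dense:
  assumes "poly_fun pairs12 p" "p c \<noteq> 0"
  shows "\<exists>b. denom b \<noteq> 0 \<and> p (\<lambda>(i, j). E (pt b False) (pt b True) i j) \<noteq> 0"
proof -
  obtain h :: "66 \<Rightarrow> nat" where h: "bij_betw h UNIV {..<66}"
    using finite_same_card_bij[of "UNIV :: 66 set" "{..<66::nat}"] by auto
  have "bij_betw ((!) pair_list) {..<66} pairs12"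
    using bij_betw_nth[OF distinct_pair_list _ set_pair_list[symmetric]] by (simp add: length_pair_list)
  then have "bij_betw (\<lambda>r. pair_list ! h r) UNIV pairs12"
    using bij_betw_trans[OF h] by (simp add: o_def)
  then show ?thesis
  proof (rule ex_nonvanishing[OF _ denom_base_conf _ assms, where u = "\<lambda>l. realise (block (directions ! h l))"])
    fix t :: "real^66"
    let ?A = "\<lambda>k l. jac_int (pair_list ! k) (directions ! l)"
    define g where "g = the_inv_into UNIV h"
    have gh: "g (h l) = l" for l
      using h by (simp add: g_def bij_betw_def the_inv_into_f_f)
    assume *: "(\<Sum>l\<in>UNIV. t $ l * jac base_conf (realise (block (directions ! h l))) (pair_list ! h r)) = 0" for r
    have sum: "(\<Sum>l<66. t $ g l * of_int (?A k l)) = 0" if k: "k < 66" for k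
    proof -
      obtain r where r: "k = h r" using k bij_betw_imp_surj_on[OF h] by blast
      have "(\<Sum>l<66. t $ g l * of_int (?A k l)) = (\<Sum>l\<in>UNIV. t $ g (h l) * of_int (?A k (h l)))"
        by (rule sum.reindex_bij_betw[OF h, symmetric])
      then show ?thesis using *[of r, unfolded jac_base_conf] by (simp add: gh r)
    qed
    note tri = lower_triangular_nth[OF lower_triangular_directions, unfolded length_map length_pair_list]
    have "t $ g l = 0" if "l < 66" for l
    proof (rule lower_triangular_mod_prime_kernel[of 5 66 ?A "\<lambda>l. t $ g l", OF _ _ _ sum that])
      show "prime (5::int)" by simp
      show "\<not> 5 dvd ?A k k" if "k < 66" for k
        using tri(2)[OF that] that by (simp add: entry_mod_eq length_pair_list dvd_eq_mod_eq_0)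
      show "5 dvd ?A k l" if "k < l" "l < 66" for k l
        using tri(3)[OF that] that by (simp add: entry_mod_eq length_pair_list dvd_eq_mod_eq_0)
    qed
    then have "t $ l = 0" for l
      using gh[of l] h by (metis UNIV_I bij_betwE lessThan_iff)
    then show "t = 0" by (simp add: vec_eq_iff)
  qed
qed

theorem theorem3p6:
  shows "generic pairs12 (\<lambda>c. finite_up_to_rigid {(x, y). solution c x y})
       \<and> generic (UNIV \<times> {1..12} \<times> UNIV)
           (\<lambda>a::bool \<times> nat \<times> 3 \<Rightarrow> real.
              finite_up_to_rigid {(x, y). solution
                 (\<lambda>(i, j). E (\<lambda>i. \<chi> k. a (False, i, k)) (\<lambda>i. \<chi> k. a (True, i, k)) i j) x y})"
proof
  show *: "generic pairs12 (\<lambda>c. finite_up_to_rigid {(x, y). solution c x y})"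
    by (rule generic_finite_up_to_rigid)
  have pt: "(\<lambda>i. \<chi> k. a (b, i, k)) = pt a b" for a b by (simp add: pt_def fun_eq_iff)
  let ?E = "\<lambda>a (i, j). E (pt a False) (pt a True) i j"
  obtain p c where p: "poly_fun pairs12 p" "p c \<noteq> 0"
    "\<And>c. p c \<noteq> 0 \<Longrightarrow> finite_up_to_rigid {(x, y). solution c x y}"
    using * unfolding generic_def by blast
  obtain b where b: "denom b \<noteq> 0" "p (?E b) \<noteq> 0" using image_dense[OF p(1,2)] by blast
  obtain r m where r: "poly_fun coords r" "\<And>a. denom a \<noteq> 0 \<Longrightarrow> r a = denom a ^ m * p (?E a)"
    using poly_fun_clear_denominators[OF p(1)] by blast
  have "poly_fun coords (\<lambda>a. denom a * r a)" by (intro poly_fun.mult poly_fun_denom r(1))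
  moreover have "denom b * r b \<noteq> 0" using b r(2) by simp
  moreover have "finite_up_to_rigid {(x, y). solution (?E a) x y}" if "denom a * r a \<noteq> 0" for a
    using that r(2)[of a] p(3) by auto
  ultimately show "generic (UNIV \<times> {1..12} \<times> UNIV)
           (\<lambda>a::bool \<times> nat \<times> 3 \<Rightarrow> real.
              finite_up_to_rigid {(x, y). solution
                 (\<lambda>(i, j). E (\<lambda>i. \<chi> k. a (False, i, k)) (\<lambda>i. \<chi> k. a (True, i, k)) i j) x y})"
    unfolding generic_def coords_def pt by blast
qed

end
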